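(* Let $k\ge 2$ be an integer and let $\gamma_{1}=\cdots=\gamma_{k-1}$ be equal nonnegative reals. For every function $g:\mathcal S_k\to\mathbb R$, $$\sum_{\sigma\in \mathcal S_k} \sum_{i=1}^{k-1} \gamma_{i} [g(\sigma) - g((ik)\sigma)]^2\ge \sum_{\sigma\in \mathcal S_k} \sum_{1\le i<j\le k-1} \frac{\gamma_{i}\gamma_{j}}{\gamma_{1}+\cdots+\gamma_{k-1}} [g(\sigma) - g((ij)\sigma)]^2 .$$
   Context: $\mathcal S_k$ is the symmetric group on $\{1,\ldots,k\}$; $(ij)$ is the transposition of $i$ and $j$; permutations are multiplied from right to left ($\sigma'\sigma$ means first $\sigma$, then $\sigma'$). An empty sum is zero, and if $\gamma_1=\cdots=\gamma_{k-1}=0$ the fractions are read as $0$. *)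

theory Defs
  imports Complex_Main "HOL-Combinatorics.Permutations"
begin

end

theory Submission
  imports Defs "HOL-Analysis.Function_Topology"
begin

text \<open>
  Write \<open>X\<^sub>m = (1 m) + \<dots> + (m-1 m)\<close> for the Jucys-Murphy elements, acting by left multiplication on
  functions on the symmetric group, and \<open>Z\<^sub>m = X\<^sub>1 + \<dots> + X\<^sub>m\<close>. For equal rates the inequality says
  that \<open>A\<^sub>m = m(m-1)/2 + Z\<^sub>m - m X\<^sub>m\<close> is positive semidefinite for \<open>m = k\<close>, which is
  shown by induction on \<open>m\<close>.

  All \<open>X\<^sub>j\<close> commute, so it suffices to consider a common eigenvector \<open>v\<close> of \<open>X\<^bsub>m-1\<^esub>\<close>, \<open>X\<^sub>m\<close> and
  \<open>Z\<^bsub>m-2\<^esub>\<close>, with eigenvalues \<open>a\<close>, \<open>b\<close>, \<open>c\<close>. Put \<open>d = b - a\<close>. Since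
  \<open>A\<^sub>m = A\<^bsub>m-1\<^esub> + (m-1)(1 + X\<^bsub>m-1\<^esub> - X\<^sub>m)\<close>, the case \<open>d \<le> 1\<close> is immediate. If \<open>d > 1\<close>, then with
  \<open>s = (m-1 m)\<close> the vector \<open>u = v - d s v\<close> satisfies \<open>|u|\<^sup>2 = (d\<^sup>2 - 1)|v|\<^sup>2 > 0\<close>
  and \<open>X\<^bsub>m-1\<^esub> u = b u\<close>, \<open>Z\<^bsub>m-2\<^esub> u = c u\<close>. The induction hypothesis for \<open>u\<close> gives
  \<open>(m-1)(m-2)/2 + c - (m-2) b \<ge> 0\<close>; the one for \<open>v\<close> multiplied by the sign character gives
  \<open>(m-1)(m-2)/2 - c + (m-2) a \<ge> 0\<close>. Their sum yields \<open>d \<le> m-1\<close>, and then the first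
  one shows that \<open>A\<^sub>m\<close> is nonnegative at \<open>v\<close>.
\<close>

section \<open>Symmetric operators on functions with finite support\<close>

definition supported :: "'a set \<Rightarrow> ('a \<Rightarrow> real) \<Rightarrow> bool" where
  "supported S f \<longleftrightarrow> (\<forall>x. x \<notin> S \<longrightarrow> f x = 0)"

definition ip :: "'a set \<Rightarrow> ('a \<Rightarrow> real) \<Rightarrow> ('a \<Rightarrow> real) \<Rightarrow> real" where
  "ip S f g = (\<Sum>x\<in>S. f x * g x)"

text \<open>Vectors are total functions vanishing off \<open>S\<close>, so every operator acts on
  one function type. That type may be infinite-dimensional, where linearity does not give
  continuity; hence the separate continuity clause.\<close>

definition symop :: "'a set \<Rightarrow> (('a \<Rightarrow> real) \<Rightarrow> 'a \<Rightarrow> real) \<Rightarrow> bool" where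
  "symop S A \<longleftrightarrow>
     (\<forall>f. supported S f \<longrightarrow> supported S (A f)) \<and>
     (\<forall>f g c. A (\<lambda>x. f x + c * g x) = (\<lambda>x. A f x + c * A g x)) \<and>
     (\<forall>x. continuous_on UNIV (\<lambda>f. A f x)) \<and>
     (\<forall>f g. supported S f \<longrightarrow> supported S g \<longrightarrow> ip S f (A g) = ip S (A f) g)"

lemma symop_supported: "symop S A \<Longrightarrow> supported S f \<Longrightarrow> supported S (A f)"
  by (rule symop_def[THEN iffD1, THEN conjunct1, rule_format])

lemma symop_linear: "symop S A \<Longrightarrow> A (\<lambda>x. f x + c * g x) = (\<lambda>x. A f x + c * A g x)"
  by (rule symop_def[THEN iffD1, THEN conjunct2, THEN conjunct1, rule_format])

lemma symop_continuous: "symop S A \<Longrightarrow> continuous_on UNIV (\<lambda>f. A f x)"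
  by (rule symop_def[THEN iffD1, THEN conjunct2, THEN conjunct2, THEN conjunct1, rule_format])

lemma symop_sym: "symop S A \<Longrightarrow> supported S f \<Longrightarrow> supported S g \<Longrightarrow> ip S f (A g) = ip S (A f) g"
  by (rule symop_def[THEN iffD1, THEN conjunct2, THEN conjunct2, THEN conjunct2, rule_format])

lemma ip_commute: "ip S f g = ip S g f"
  by (simp add: ip_def mult.commute)

lemma ip_add_right: "ip S f (\<lambda>x. g x + c * h x) = ip S f g + c * ip S f h"
  by (simp add: ip_def algebra_simps sum.distrib sum_distrib_left)

lemma ip_add_left: "ip S (\<lambda>x. g x + c * h x) f = ip S g f + c * ip S h f"
  using ip_add_right[of S f g c h] by (simp add: ip_commute)

lemma ip_cmult_right: "ip S f (\<lambda>x. c * h x) = c * ip S f h"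
  by (simp add: ip_def algebra_simps sum_distrib_left)

lemma ip_cmult_left: "ip S (\<lambda>x. c * h x) f = c * ip S h f"
  by (simp add: ip_def algebra_simps sum_distrib_left)

lemma ip_self_nonneg: "0 \<le> ip S f f"
  by (simp add: ip_def sum_nonneg)

lemma ip_self_eq_0:
  assumes "finite S" "supported S f" "ip S f f = 0"
  shows "f = (\<lambda>x. 0)"
proof
  fix x
  have "\<forall>x\<in>S. f x * f x = 0"
    using assms(1,3) by (simp add: ip_def sum_nonneg_eq_0_iff)
  then show "f x = 0" using assms(2) by (auto simp: supported_def)
qed

lemma ip_self_pos:
  assumes "finite S" "supported S f" "f \<noteq> (\<lambda>x. 0)"
  shows "0 < ip S f f"
  using ip_self_eq_0[OF assms(1,2)] assms(3) ip_self_nonneg[of S f] by fastforce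

lemma continuous_on_coordinate: "continuous_on A (\<lambda>f::'a \<Rightarrow> real. f x)"
  by (rule continuous_on_subset[OF continuous_on_product_coordinates]) simp

lemma supported_add_cmult:
  "supported S f \<Longrightarrow> supported S g \<Longrightarrow> supported S (\<lambda>x. f x + c * g x)"
  by (auto simp: supported_def)

lemma symop_cmult_id: "symop S (\<lambda>f x. c * f x)"
  unfolding symop_def
proof (intro conjI allI impI)
  show "continuous_on UNIV (\<lambda>f::'a \<Rightarrow> real. c * f x)" for x
    by (rule continuous_on_mult_left) (rule continuous_on_coordinate)
  show "(\<lambda>x. c * (f x + e * g x)) = (\<lambda>x. c * f x + e * (c * g x))" for f g :: "'a \<Rightarrow> real" and e
    by (simp add: distrib_left mult.left_commute)
qed (simp_all add: supported_def ip_cmult_left ip_cmult_right)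

lemma add_cmult_swap: "a + e * b + c * (a' + e * b') = a + c * a' + e * (b + c * b')"
  for a b a' b' c e :: real
  by (simp add: algebra_simps)

lemma symop_add_cmult:
  assumes A: "symop S A" and B: "symop S B"
  shows "symop S (\<lambda>f x. A f x + c * B f x)"
  unfolding symop_def
proof (intro conjI allI impI)
  fix f g :: "'a \<Rightarrow> real" and e x
  show "supported S (\<lambda>x. A f x + c * B f x)" if "supported S f"
    by (intro supported_add_cmult symop_supported[OF A that] symop_supported[OF B that])
  show "(\<lambda>x. A (\<lambda>x. f x + e * g x) x + c * B (\<lambda>x. f x + e * g x) x) =
        (\<lambda>x. A f x + c * B f x + e * (A g x + c * B g x))"
    unfolding symop_linear[OF A] symop_linear[OF B] by (rule ext) (rule add_cmult_swap)
  show "continuous_on UNIV (\<lambda>f. A f x + c * B f x)"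
    by (rule continuous_on_add continuous_on_mult_left symop_continuous[OF A] symop_continuous[OF B])+
  show "ip S f (\<lambda>x. A g x + c * B g x) = ip S (\<lambda>x. A f x + c * B f x) g"
    if "supported S f" "supported S g"
    unfolding ip_add_left ip_add_right symop_sym[OF A that] symop_sym[OF B that] ..
qed

lemma symop_sum:
  assumes "finite I" "\<And>i. i \<in> I \<Longrightarrow> symop S (F i)"
  shows "symop S (\<lambda>f x. \<Sum>i\<in>I. F i f x)"
  using assms
proof (induction I rule: finite_induct)
  case empty
  then show ?case using symop_cmult_id[of S 0] by simp
next
  case (insert i I)
  then have "symop S (\<lambda>f x. F i f x + 1 * (\<Sum>i\<in>I. F i f x))"
    by (intro symop_add_cmult) auto
  then show ?case using insert.hyps by simp
qed

section \<open>Existence of eigenvectors and common eigenvectors\<close>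

text \<open>The Rayleigh quotient attains its minimum on the compact unit sphere of
  \<open>K\<close>, and a minimiser is an eigenvector. Allowing any closed invariant subspace
  \<open>K\<close> lets the lemma be applied again inside eigenspaces.\<close>

lemma exists_min_eigenvector:
  fixes A :: "('a \<Rightarrow> real) \<Rightarrow> 'a \<Rightarrow> real"
  assumes S: "finite S" and A: "symop S A"
    and K: "closed K" "\<And>f. f \<in> K \<Longrightarrow> supported S f"
      "\<And>f g c. f \<in> K \<Longrightarrow> g \<in> K \<Longrightarrow> (\<lambda>x. f x + c * g x) \<in> K"
      "\<And>f. f \<in> K \<Longrightarrow> A f \<in> K"
    and f0: "f0 \<in> K" "f0 \<noteq> (\<lambda>x. 0)"
  obtains l v where "v \<in> K" "v \<noteq> (\<lambda>x. 0)" "A v = (\<lambda>x. l * v x)"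
    "\<And>h. h \<in> K \<Longrightarrow> l * ip S h h \<le> ip S h (A h)"
proof -
  have zero: "(\<lambda>x. 0) \<in> K"
    using K(3)[of f0 f0 "-1"] f0 by simp
  have scale: "(\<lambda>x. c * f x) \<in> K" if "f \<in> K" for c f
    using K(3)[OF zero that, of c] by simp
  \<comment> \<open>A cube in the coordinates of \<open>S\<close> with a single point elsewhere:
    compact by Tychonoff, and it contains every supported unit vector.\<close>
  define B where "B = Pi\<^sub>E UNIV (\<lambda>x. if x \<in> S then {-1..1::real} else {0})"
  define C where "C = B \<inter> (K \<inter> {f. ip S f f = 1})"
  have cont_ip: "continuous_on UNIV (\<lambda>f. ip S f f)"
    unfolding ip_def by (intro continuous_intros continuous_on_coordinate)
  have cont_q: "continuous_on UNIV (\<lambda>f. ip S f (A f))"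
    unfolding ip_def by (intro continuous_intros continuous_on_coordinate symop_continuous[OF A])
  have "compactin (product_topology (\<lambda>_. euclidean) UNIV) B"
    unfolding B_def by (subst compactin_PiE) auto
  then have "compact B"
    by (simp add: euclidean_product_topology)
  moreover have "closed {f. ip S f f = 1}"
    by (intro closed_Collect_eq cont_ip continuous_intros)
  ultimately have "compact C"
    unfolding C_def using K(1) by (intro compact_Int_closed closed_Int) auto
  have inB: "f \<in> B" if "supported S f" "ip S f f = 1" for f
  proof -
    have "\<bar>f x\<bar> \<le> 1" if "x \<in> S" for x
    proof -
      have "f x * f x \<le> ip S f f"
        unfolding ip_def by (rule member_le_sum) (use that S in auto)
      then have "(f x)\<^sup>2 \<le> 1" using \<open>ip S f f = 1\<close> by (simp add: power2_eq_square)
      then show ?thesis by (simp add: abs_square_le_1)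
    qed
    then show ?thesis using that(1) by (auto simp: B_def supported_def abs_le_iff)
  qed
  have normalize: "(\<lambda>x. (1 / sqrt (ip S f f)) * f x) \<in> C" if "f \<in> K" "f \<noteq> (\<lambda>x. 0)" for f
  proof -
    have pos: "0 < ip S f f" by (rule ip_self_pos) (use S K that in auto)
    have "ip S (\<lambda>x. (1 / sqrt (ip S f f)) * f x) (\<lambda>x. (1 / sqrt (ip S f f)) * f x) = 1"
      unfolding ip_cmult_left ip_cmult_right using pos by simp
    then show ?thesis using inB scale[OF that(1)] K(2) unfolding C_def by blast
  qed
  then have "C \<noteq> {}" using f0 by blast
  obtain v where v: "v \<in> C" and vmin: "\<And>f. f \<in> C \<Longrightarrow> ip S v (A v) \<le> ip S f (A f)"
    using continuous_attains_inf[OF \<open>compact C\<close> \<open>C \<noteq> {}\<close> continuous_on_subset[OF cont_q]] by auto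
  define l where "l = ip S v (A v)"
  have vK: "v \<in> K" and v1: "ip S v v = 1" using v by (auto simp: C_def)
  have A0: "A (\<lambda>x. 0) = (\<lambda>x. 0)" using symop_linear[OF A, of v "-1" v] by simp
  have Asc: "A (\<lambda>x. c * f x) = (\<lambda>x. c * A f x)" for c f
    using symop_linear[OF A, of "\<lambda>x. 0" c f] A0 by simp
  have lmin: "l * ip S h h \<le> ip S h (A h)" if "h \<in> K" for h
  proof (cases "h = (\<lambda>x. 0)")
    case True
    then show ?thesis by (simp add: ip_def)
  next
    case False
    have pos: "0 < ip S h h" by (rule ip_self_pos) (use S K that False in auto)
    have "l \<le> ip S (\<lambda>x. (1 / sqrt (ip S h h)) * h x) (A (\<lambda>x. (1 / sqrt (ip S h h)) * h x))"
      unfolding l_def by (rule vmin) (rule normalize[OF that False])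
    also have "\<dots> = ip S h (A h) / ip S h h"
      unfolding Asc ip_cmult_left ip_cmult_right using pos by (simp add: field_simps)
    finally show ?thesis using pos by (simp add: field_simps)
  qed
  \<comment> \<open>Perturbing the minimiser \<open>v\<close> in the direction of \<open>w = A v - l v\<close> forces \<open>w = 0\<close>.\<close>
  define w where "w = (\<lambda>x. A v x + (-l) * v x)"
  have wK: "w \<in> K" unfolding w_def by (intro K vK)
  define W where "W = ip S w w"
  have vA: "ip S v (A w) = ip S w (A v)"
    using symop_sym[OF A K(2)[OF vK] K(2)[OF wK]] by (simp add: ip_commute)
  have W: "ip S w (A v) - l * ip S w v = W"
  proof -
    have "W = ip S w (\<lambda>x. A v x + (-l) * v x)"
      unfolding W_def by (rule arg_cong[where f = "ip S w", OF w_def])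
    then show ?thesis by (simp only: ip_add_right)
  qed
  define Q where "Q = ip S w (A w) - l * ip S w w"
  \<comment> \<open>Minimality of \<open>l\<close> tested at \<open>v + t w\<close>; the terms free
    of \<open>t\<close> cancel.\<close>
  have ineq: "0 \<le> 2 * t * W + t\<^sup>2 * Q" for t
  proof -
    have "l * ip S (\<lambda>x. v x + t * w x) (\<lambda>x. v x + t * w x)
        \<le> ip S (\<lambda>x. v x + t * w x) (A (\<lambda>x. v x + t * w x))"
      by (intro lmin K vK wK)
    then have "l * (1 + t * ip S v w + t * (ip S w v + t * ip S w w))
        \<le> ip S v (A v) + t * ip S v (A w) + t * (ip S w (A v) + t * ip S w (A w))"
      by (simp add: symop_linear[OF A] ip_add_left ip_add_right v1)
    then show ?thesis
      unfolding vA ip_commute[of S v w] l_def[symmetric] Q_def W[symmetric]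
      by (simp add: algebra_simps power2_eq_square)
  qed
  have "W = 0"
  proof (rule ccontr)
    assume "W \<noteq> 0"
    then have Wp: "0 < W" using ip_self_nonneg[of S w] by (simp add: W_def less_le)
    \<comment> \<open>If \<open>Q \<le> 0\<close>, then \<open>t = -1\<close> gives
      \<open>Q - 2 W < 0\<close>. Otherwise the vertex \<open>t = - W / Q\<close> of the parabola
      gives \<open>- W^2 / Q < 0\<close>.\<close>
    show False
    proof (cases "Q \<le> 0")
      case True
      then show False using ineq[of "-1"] Wp by simp
    next
      case False
      then show False using ineq[of "- W / Q"] Wp
        by (simp add: field_simps power2_eq_square) (metis mult_pos_pos not_le)
    qed
  qed
  then have w0: "w = (\<lambda>x. 0)"
    using ip_self_eq_0[OF S K(2)[OF wK]] by (simp add: W_def)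
  have "A v = (\<lambda>x. l * v x)"
  proof
    fix x show "A v x = l * v x" using fun_cong[OF w0, of x] by (simp add: w_def)
  qed
  moreover have "v \<noteq> (\<lambda>x. 0)" using v1 by (auto simp: ip_def)
  ultimately show thesis using that vK lmin by blast
qed

lemma closed_eigenspace:
  assumes "symop S A"
  shows "closed {f. A f = (\<lambda>x. l * f x)}"
proof -
  have "closed {f. \<forall>x. A f x = l * f x}"
    by (intro closed_Collect_all closed_Collect_eq symop_continuous[OF assms]
        continuous_intros continuous_on_coordinate)
  then show ?thesis by (simp add: fun_eq_iff)
qed

text \<open>Induction on the list: an eigenspace of the first operator inside \<open>K\<close> is
  again a closed subspace, and it is invariant under the remaining operators because they commute
  with the first.\<close>

lemma exists_joint_eigenvector:
  assumes S: "finite S" and As: "\<And>A. A \<in> set As \<Longrightarrow> symop S A"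
    and comm: "\<And>A B f. A \<in> set As \<Longrightarrow> B \<in> set As \<Longrightarrow> A (B f) = B (A f)"
    and K: "closed K" "\<And>f. f \<in> K \<Longrightarrow> supported S f"
      "\<And>f g c. f \<in> K \<Longrightarrow> g \<in> K \<Longrightarrow> (\<lambda>x. f x + c * g x) \<in> K"
      "\<And>A f. A \<in> set As \<Longrightarrow> f \<in> K \<Longrightarrow> A f \<in> K"
    and f0: "f0 \<in> K" "f0 \<noteq> (\<lambda>x. 0)"
  shows "\<exists>v\<in>K. v \<noteq> (\<lambda>x. 0) \<and> (\<forall>A\<in>set As. \<exists>l. A v = (\<lambda>x. l * v x))"
  using As comm K f0
proof (induction As arbitrary: K f0)
  case Nil
  then show ?case by auto
next
  case (Cons A As)
  have A: "symop S A" using Cons.prems(1) by simp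
  obtain l v where v: "v \<in> K" "v \<noteq> (\<lambda>x. 0)" "A v = (\<lambda>x. l * v x)"
    by (rule exists_min_eigenvector[OF S A Cons.prems(3,4,5) _ Cons.prems(7,8)])
      (use Cons.prems(6) in auto)
  define K' where "K' = K \<inter> {f. A f = (\<lambda>x. l * f x)}"
  have "\<exists>v\<in>K'. v \<noteq> (\<lambda>x. 0) \<and> (\<forall>A\<in>set As. \<exists>l. A v = (\<lambda>x. l * v x))"
  proof (rule Cons.IH)
    show "closed K'" unfolding K'_def
      by (intro closed_Int Cons.prems(3) closed_eigenspace[OF A])
    show "(\<lambda>x. f x + c * g x) \<in> K'" if "f \<in> K'" "g \<in> K'" for f g c
      using that Cons.prems(5)[of f g c]
      by (auto simp: K'_def symop_linear[OF A] algebra_simps)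
    show "B f \<in> K'" if B: "B \<in> set As" and f: "f \<in> K'" for B f
    proof -
      have Bsym: "symop S B" using B Cons.prems(1) by simp
      have B0: "B (\<lambda>x. 0) = (\<lambda>x. 0)" using symop_linear[OF Bsym, of f "-1" f] by simp
      have "A (B f) = B (A f)" by (rule Cons.prems(2)) (use B in auto)
      also have "\<dots> = B (\<lambda>x. l * f x)" using f by (simp add: K'_def)
      also have "\<dots> = (\<lambda>x. l * B f x)"
        using symop_linear[OF Bsym, of "\<lambda>x. 0" l f] B0 by simp
      finally show ?thesis using f B Cons.prems(6) by (simp add: K'_def)
    qed
  qed (use v Cons.prems in \<open>auto simp: K'_def\<close>)
  then show ?case by (auto simp: K'_def)
qed

text \<open>The eigenspace of \<open>A\<close> for its least eigenvalue \<open>l\<close> is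
  invariant under all of \<open>Bs\<close>, so it contains a joint eigenvector \<open>v\<close>.
  There the form equals \<open>l\<close> times the squared norm of \<open>v\<close>, so
  \<open>eig\<close> forces \<open>l \<ge> 0\<close>.\<close>

lemma psd_of_joint_eigenvalues:
  assumes S: "finite S" and A: "symop S A" and As: "\<And>B. B \<in> set Bs \<Longrightarrow> symop S B"
    and comm: "\<And>B f. B \<in> set Bs \<Longrightarrow> A (B f) = B (A f)"
      "\<And>B C f. B \<in> set Bs \<Longrightarrow> C \<in> set Bs \<Longrightarrow> B (C f) = C (B f)"
    and eig: "\<And>v. supported S v \<Longrightarrow> v \<noteq> (\<lambda>x. 0) \<Longrightarrow>
        (\<And>B. B \<in> set Bs \<Longrightarrow> \<exists>l. B v = (\<lambda>x. l * v x)) \<Longrightarrow> 0 \<le> ip S v (A v)"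
    and f: "supported S f"
  shows "0 \<le> ip S f (A f)"
proof (cases "f = (\<lambda>x. 0)")
  case True
  then show ?thesis by (simp add: ip_def)
next
  case False
  define K where "K = {f. supported S f}"
  have "closed {f. \<forall>x. x \<notin> S \<longrightarrow> f x = (0::real)}"
    by (intro closed_Collect_all closed_Collect_imp closed_Collect_eq open_Collect_const
        continuous_intros continuous_on_coordinate)
  then have clK: "closed K" by (simp add: K_def supported_def)
  obtain l v0 where v0: "v0 \<in> K" "v0 \<noteq> (\<lambda>x. 0)" "A v0 = (\<lambda>x. l * v0 x)"
    and lmin: "\<And>h. h \<in> K \<Longrightarrow> l * ip S h h \<le> ip S h (A h)"
    by (rule exists_min_eigenvector[OF S A clK _ _ _ _ False])
      (use f in \<open>auto simp: K_def intro: supported_add_cmult symop_supported[OF A]\<close>)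
  define K' where "K' = K \<inter> {f. A f = (\<lambda>x. l * f x)}"
  have "\<exists>v\<in>K'. v \<noteq> (\<lambda>x. 0) \<and> (\<forall>A\<in>set Bs. \<exists>l. A v = (\<lambda>x. l * v x))"
  proof (rule exists_joint_eigenvector[OF S])
    show "symop S B" if "B \<in> set Bs" for B using that by (rule As)
    show "B (C f) = C (B f)" if "B \<in> set Bs" "C \<in> set Bs" for B C f using that by (rule comm(2))
    show "closed K'" unfolding K'_def by (intro closed_Int clK closed_eigenspace[OF A])
    show "(\<lambda>x. f x + c * g x) \<in> K'" if "f \<in> K'" "g \<in> K'" for f g c
      using that supported_add_cmult[of S f g c]
      by (auto simp: K'_def K_def symop_linear[OF A] algebra_simps)
    show "B f \<in> K'" if B: "B \<in> set Bs" and f: "f \<in> K'" for B f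
    proof -
      have Bsym: "symop S B" using B As by simp
      have B0: "B (\<lambda>x. 0) = (\<lambda>x. 0)" using symop_linear[OF Bsym, of f "-1" f] by simp
      have "A (B f) = B (A f)" by (rule comm(1)[OF B])
      also have "\<dots> = B (\<lambda>x. l * f x)" using f by (simp add: K'_def)
      also have "\<dots> = (\<lambda>x. l * B f x)"
        using symop_linear[OF Bsym, of "\<lambda>x. 0" l f] B0 by simp
      finally show ?thesis using f symop_supported[OF Bsym] by (simp add: K'_def K_def)
    qed
  qed (use v0 in \<open>auto simp: K'_def K_def\<close>)
  then obtain v where v: "supported S v" "v \<noteq> (\<lambda>x. 0)" "A v = (\<lambda>x. l * v x)"
    and Bv: "\<forall>B\<in>set Bs. \<exists>l. B v = (\<lambda>x. l * v x)"
    by (auto simp: K'_def K_def)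
  have "0 \<le> l * ip S v v" using eig[OF v(1,2)] Bv v(3) by (simp add: ip_cmult_right)
  then have "0 \<le> l" using ip_self_pos[OF S v(1,2)] by (simp add: zero_le_mult_iff)
  then have "0 \<le> l * ip S f f" by (simp add: ip_self_nonneg)
  also have "\<dots> \<le> ip S f (A f)" using lmin f by (simp add: K_def)
  finally show ?thesis .
qed

section \<open>Jucys-Murphy operators\<close>

abbreviation perms :: "nat \<Rightarrow> (nat \<Rightarrow> nat) set" where
  "perms k \<equiv> {\<sigma>. \<sigma> permutes {1..k}}"

text \<open>Composition reverses the order of the transpositions:
  \<open>trop a b (trop c d f)\<close> evaluates \<open>f\<close> at
  \<open>transpose c d \<circ> transpose a b \<circ> \<sigma>\<close>.\<close>

definition trop :: "nat \<Rightarrow> nat \<Rightarrow> ((nat \<Rightarrow> nat) \<Rightarrow> real) \<Rightarrow> (nat \<Rightarrow> nat) \<Rightarrow> real" where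
  "trop a b f = (\<lambda>\<sigma>. f (transpose a b \<circ> \<sigma>))"

definition jm :: "nat \<Rightarrow> ((nat \<Rightarrow> nat) \<Rightarrow> real) \<Rightarrow> (nat \<Rightarrow> nat) \<Rightarrow> real" where
  "jm m f = (\<lambda>\<sigma>. \<Sum>i\<in>{1..<m}. trop i m f \<sigma>)"

text \<open>Grouped by the larger entry, this is the sum of all transpositions of
  \<open>{1..m}\<close>.\<close>

definition jmsum :: "nat \<Rightarrow> ((nat \<Rightarrow> nat) \<Rightarrow> real) \<Rightarrow> (nat \<Rightarrow> nat) \<Rightarrow> real" where
  "jmsum m f = (\<lambda>\<sigma>. \<Sum>j\<in>{1..m}. jm j f \<sigma>)"

text \<open>The operator \<open>A\<^sub>m\<close>. For \<open>k = m \<ge> 2\<close> and unit rates,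
  the difference of the two sides of the theorem is \<open>2 / (m - 1)\<close> times its quadratic
  form.\<close>

definition octo :: "nat \<Rightarrow> ((nat \<Rightarrow> nat) \<Rightarrow> real) \<Rightarrow> (nat \<Rightarrow> nat) \<Rightarrow> real" where
  "octo m f = (\<lambda>\<sigma>. real m * (real m - 1) / 2 * f \<sigma> + jmsum m f \<sigma> + (- real m) * jm m f \<sigma>)"

lemma finite_perms: "finite (perms k)"
  by (simp add: finite_permutations)

text \<open>Conjugating a transposition relabels its entries.\<close>

lemma transpose_comp_transpose:
  "transpose c d \<circ> transpose a b = transpose (transpose c d a) (transpose c d b) \<circ> transpose c d"
  by (auto simp: fun_eq_iff transpose_def)

lemma transpose_comp_permutes_iff:
  assumes "a \<in> A" "b \<in> A"
  shows "transpose a b \<circ> \<sigma> permutes A \<longleftrightarrow> \<sigma> permutes A"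
proof
  have t: "transpose a b permutes A" using assms by (rule permutes_swap_id)
  show "transpose a b \<circ> \<sigma> permutes A" if "\<sigma> permutes A"
    using that t by (rule permutes_compose)
  show "\<sigma> permutes A" if "transpose a b \<circ> \<sigma> permutes A"
    using permutes_compose[OF that t] by (simp add: comp_assoc[symmetric])
qed

lemma trop_trop: "trop a b (trop a b f) = f"
  by (simp add: trop_def comp_assoc[symmetric])

lemma ip_trop:
  assumes "a \<in> {1..k}" "b \<in> {1..k}"
  shows "ip (perms k) f (trop a b g) = ip (perms k) (trop a b f) g"
  unfolding ip_def
  by (rule sum.reindex_bij_witness[of _ "\<lambda>\<sigma>. transpose a b \<circ> \<sigma>" "\<lambda>\<sigma>. transpose a b \<circ> \<sigma>"])
    (use assms in \<open>auto simp: trop_def comp_assoc[symmetric] transpose_comp_permutes_iff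
      simp del: atLeastAtMost_iff\<close>)

lemma symop_trop:
  assumes "a \<in> {1..k}" "b \<in> {1..k}"
  shows "symop (perms k) (trop a b)"
  unfolding symop_def
proof (intro conjI allI impI)
  show "supported (perms k) (trop a b f)" if "supported (perms k) f" for f
    using that assms unfolding supported_def trop_def
    by (simp add: transpose_comp_permutes_iff del: atLeastAtMost_iff)
  show "continuous_on UNIV (\<lambda>f. trop a b f \<sigma>)" for \<sigma>
    unfolding trop_def by (rule continuous_on_coordinate)
  show "ip (perms k) f (trop a b g) = ip (perms k) (trop a b f) g" for f g
    by (rule ip_trop[OF assms])
qed (simp add: trop_def)

lemma symop_jm: "m \<le> k \<Longrightarrow> symop (perms k) (jm m)"
  unfolding jm_def[abs_def] by (intro symop_sum symop_trop) auto

lemma symop_jmsum: "m \<le> k \<Longrightarrow> symop (perms k) (jmsum m)"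
  unfolding jmsum_def[abs_def] by (intro symop_sum symop_jm) auto

lemma symop_octo:
  assumes "m \<le> k"
  shows "symop (perms k) (octo m)"
  using symop_add_cmult[OF symop_add_cmult[OF symop_cmult_id symop_jmsum[OF assms], of _ 1]
      symop_jm[OF assms], of "real m * (real m - 1) / 2" "- real m"]
  by (simp add: octo_def[abs_def])

section \<open>Commutation relations\<close>

lemma jm_sum: "jm m (\<lambda>\<sigma>. \<Sum>i\<in>I. F i \<sigma>) = (\<lambda>\<sigma>. \<Sum>i\<in>I. jm m (F i) \<sigma>)"
  unfolding jm_def trop_def by (rule ext, rule sum.swap)

text \<open>In both cases \<open>transpose c d\<close> fixes \<open>m\<close> and maps
  \<open>{1..<m}\<close> to itself, so conjugation by it only permutes the summands of
  \<open>jm m\<close>.\<close>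

lemma trop_jm_commute:
  assumes "c \<in> {1..<m} \<and> d \<in> {1..<m} \<or> m < c \<and> m < d"
  shows "trop c d (jm m f) = jm m (trop c d f)"
proof
  fix \<sigma>
  let ?t = "transpose c d"
  have m: "?t m = m" using assms by (auto simp: transpose_def)
  have tt: "?t (?t i) = i" for i by simp
  have mem: "?t i \<in> {1..<m}" if "i \<in> {1..<m}" for i
    using that assms by (auto simp: transpose_def)
  have "jm m (trop c d f) \<sigma> = (\<Sum>i\<in>{1..<m}. f (?t \<circ> transpose i m \<circ> \<sigma>))"
    by (simp add: jm_def trop_def comp_assoc)
  also have "\<dots> = (\<Sum>i\<in>{1..<m}. f (transpose (?t i) m \<circ> ?t \<circ> \<sigma>))"
    by (subst transpose_comp_transpose) (simp only: m)
  also have "\<dots> = (\<Sum>i\<in>{1..<m}. f (transpose i m \<circ> ?t \<circ> \<sigma>))"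
    by (rule sum.reindex_bij_witness[of _ ?t ?t]) (use mem in \<open>simp_all only: tt\<close>)
  finally show "trop c d (jm m f) \<sigma> = jm m (trop c d f) \<sigma>"
    by (simp add: jm_def trop_def comp_assoc)
qed

text \<open>For \<open>j < m\<close> each transposition in \<open>jm j\<close> has both entries
  below \<open>m\<close>, so it commutes with \<open>jm m\<close> by itself.\<close>

lemma jm_commute: "jm j (jm m f) = jm m (jm j f)"
proof -
  have *: "jm j (jm m f) = jm m (jm j f)" if "j < m" for j m
  proof -
    have "jm j (jm m f) = (\<lambda>\<sigma>. \<Sum>i\<in>{1..<j}. trop i j (jm m f) \<sigma>)"
      by (rule jm_def)
    also have "\<dots> = (\<lambda>\<sigma>. \<Sum>i\<in>{1..<j}. jm m (trop i j f) \<sigma>)"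
      by (intro ext sum.cong refl) (use that in \<open>subst trop_jm_commute, auto\<close>)
    also have "\<dots> = jm m (jm j f)"
      by (subst (2) jm_def) (rule jm_sum[symmetric])
    finally show ?thesis .
  qed
  show ?thesis using *[of j m] *[of m j] by (cases j m rule: linorder_cases) auto
qed

lemma jm_jmsum_commute: "jm j (jmsum m f) = jmsum m (jm j f)"
  unfolding jmsum_def jm_sum by (simp add: jm_commute)

lemma trop_jmsum_commute:
  assumes "m < c" "m < d"
  shows "trop c d (jmsum m f) = jmsum m (trop c d f)"
proof -
  have "trop c d (jmsum m f) = (\<lambda>\<sigma>. \<Sum>j\<in>{1..m}. trop c d (jm j f) \<sigma>)"
    by (simp add: jmsum_def trop_def)
  then show ?thesis using assms by (simp add: trop_jm_commute jmsum_def)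
qed

text \<open>Conjugation by \<open>(m m+1)\<close> turns \<open>(i m)\<close> into
  \<open>(i m+1)\<close> for \<open>i < m\<close>; the one summand of \<open>jm (Suc m)\<close> not
  reached so is \<open>(m m+1)\<close> itself.\<close>

lemma jm_Suc:
  assumes "1 \<le> m"
  shows "jm (Suc m) f \<sigma> =
    trop m (Suc m) f \<sigma> + trop m (Suc m) (jm m (trop m (Suc m) f)) \<sigma>"
proof -
  let ?s = "transpose m (Suc m)"
  have "?s \<circ> (transpose i m \<circ> (?s \<circ> \<sigma>)) = transpose i (Suc m) \<circ> \<sigma>" if "i \<in> {1..<m}" for i
    using that by (auto simp: fun_eq_iff transpose_def)
  then have "trop m (Suc m) (jm m (trop m (Suc m) f)) \<sigma> = (\<Sum>i\<in>{1..<m}. f (transpose i (Suc m) \<circ> \<sigma>))"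
    by (simp add: jm_def trop_def)
  moreover have "{1..<Suc m} = insert m {1..<m}" using assms by auto
  ultimately show ?thesis by (simp add: jm_def trop_def)
qed

lemma jmsum_Suc: "jmsum (Suc m) f \<sigma> = jmsum m f \<sigma> + jm (Suc m) f \<sigma>"
  by (simp add: jmsum_def)

lemma ip_add_right': "ip S f (\<lambda>x. g x + h x) = ip S f g + ip S f h"
  using ip_add_right[of S f g 1 h] by simp

lemma ip_octo:
  "ip S f (octo m f) = real m * (real m - 1) / 2 * ip S f f + ip S f (jmsum m f) - real m * ip S f (jm m f)"
  unfolding octo_def ip_add_right ip_add_right' ip_cmult_right by simp

section \<open>Twisting by the sign character\<close>

text \<open>Transpositions are odd. Membership of \<open>\<sigma>\<close> in \<open>perms k\<close>
  makes \<open>sign\<close> multiplicative here.\<close>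

lemma jm_sign:
  assumes "m \<le> k" "\<sigma> \<in> perms k"
  shows "jm m (\<lambda>\<sigma>. of_int (sign \<sigma>) * f \<sigma>) \<sigma> = - of_int (sign \<sigma>) * jm m f \<sigma>"
proof -
  have "permutation \<sigma>" using assms by (auto intro: permutes_imp_permutation[of "{1..k}"])
  then show ?thesis
    unfolding jm_def trop_def sum_distrib_left
    by (intro sum.cong refl) (simp add: sign_compose permutation_swap_id sign_swap_id)
qed

lemma ip_jm_sign:
  assumes "m \<le> k"
  defines "h \<equiv> \<lambda>f \<sigma>. of_int (sign \<sigma>) * f \<sigma>"
  shows "ip (perms k) (h f) (jm m (h f)) = - ip (perms k) f (jm m f)"
proof -
  have sq: "of_int (sign \<sigma>) * (of_int (sign \<sigma>) * x) = (x::real)" for \<sigma> :: "nat \<Rightarrow> nat" and x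
    by (simp add: sign_def)
  show ?thesis
    unfolding ip_def sum_negf[symmetric] h_def
    by (intro sum.cong refl, subst jm_sign[OF assms(1)])
      (simp_all add: algebra_simps sq)
qed

lemma ip_jmsum: "ip S f (jmsum m f) = (\<Sum>j\<in>{1..m}. ip S f (jm j f))"
  unfolding ip_def jmsum_def sum_distrib_left by (rule sum.swap)

text \<open>The hypothesis is applied to \<open>sign\<close> times \<open>f\<close>: the norm stays,
  while the forms of all \<open>jm j\<close> change sign.\<close>

lemma octo_sign_twist:
  assumes P: "\<And>f. supported (perms k) f \<Longrightarrow> 0 \<le> ip (perms k) f (octo m f)"
    and m: "m \<le> k" and f: "supported (perms k) f"
  shows "0 \<le> real m * (real m - 1) / 2 * ip (perms k) f f
    - ip (perms k) f (jmsum m f) + real m * ip (perms k) f (jm m f)"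
proof -
  define h where "h = (\<lambda>\<sigma>. of_int (sign \<sigma>) * f \<sigma>)"
  have "supported (perms k) h" using f by (auto simp: supported_def h_def)
  from P[OF this] have "0 \<le> ip (perms k) h (octo m h)" .
  moreover have "ip (perms k) h h = ip (perms k) f f"
    unfolding ip_def h_def by (intro sum.cong refl) (simp add: sign_def)
  moreover have "ip (perms k) h (jm j h) = - ip (perms k) f (jm j f)" if "j \<le> m" for j
    unfolding h_def using ip_jm_sign[of j k f] that m by simp
  ultimately show ?thesis
    by (simp add: ip_octo ip_jmsum sum_negf)
qed

section \<open>The induction on m\<close>

text \<open>The overview's \<open>m\<close> is \<open>n + 2\<close> here. The third operator is
  \<open>jmsum n\<close> because it commutes with \<open>s\<close>, so that \<open>u\<close> keeps
  the eigenvalue \<open>c\<close>.\<close>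

lemma octo_step:
  assumes P: "\<And>f. supported (perms k) f \<Longrightarrow> 0 \<le> ip (perms k) f (octo (Suc n) f)"
    and k: "Suc (Suc n) \<le> k" and f: "supported (perms k) f"
  shows "0 \<le> ip (perms k) f (octo (Suc (Suc n)) f)"
proof (rule psd_of_joint_eigenvalues[OF finite_perms symop_octo[OF k],
      where Bs = "[jm (Suc n), jm (Suc (Suc n)), jmsum n]"])
  have lin: "jm i (\<lambda>x. f x + c * g x) = (\<lambda>x. jm i f x + c * jm i g x)"
    "jmsum i (\<lambda>x. f x + c * g x) = (\<lambda>x. jmsum i f x + c * jmsum i g x)" for i c f g
    using symop_linear[OF symop_jm[OF order_refl]] symop_linear[OF symop_jmsum[OF order_refl]]
    by auto
  have js: "jmsum i (jmsum j f) = jmsum j (jmsum i f)" for i j f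
  proof -
    have "jmsum i (jmsum j f) = (\<lambda>\<sigma>. \<Sum>l\<in>{1..i}. jmsum j (jm l f) \<sigma>)"
      by (subst jmsum_def) (simp add: jm_jmsum_commute)
    also have "\<dots> = (\<lambda>\<sigma>. \<Sum>l\<in>{1..i}. \<Sum>p\<in>{1..j}. jm p (jm l f) \<sigma>)"
      by (simp add: jmsum_def)
    also have "\<dots> = (\<lambda>\<sigma>. \<Sum>p\<in>{1..j}. jm p (jmsum i f) \<sigma>)"
      unfolding jmsum_def jm_sum by (rule ext, rule sum.swap)
    finally show ?thesis by (simp add: jmsum_def[of j])
  qed
  have octo_comm: "octo m (B f) = B (octo m f)"
    if "\<And>i f. B (jm i f) = jm i (B f)" "\<And>i f. B (jmsum i f) = jmsum i (B f)"
      "\<And>f g c. B (\<lambda>x. f x + c * g x) = (\<lambda>x. B f x + c * B g x)" for B m f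
  proof -
    have e: "octo m f = (\<lambda>x. (jmsum m f x + (real m * (real m - 1) / 2) * f x) + (- real m) * jm m f x)" for f
      by (simp add: octo_def algebra_simps)
    show ?thesis unfolding e that by (simp add: that(1)[symmetric] that(2)[symmetric])
  qed
  show "octo (Suc (Suc n)) (B f) = B (octo (Suc (Suc n)) f)"
    if "B \<in> set [jm (Suc n), jm (Suc (Suc n)), jmsum n]" for B f
    by (rule octo_comm)
      (use that jm_commute jm_jmsum_commute js lin in \<open>auto simp: jm_commute jm_jmsum_commute js lin\<close>)
  show "B (C f) = C (B f)"
    if "B \<in> set [jm (Suc n), jm (Suc (Suc n)), jmsum n]"
      "C \<in> set [jm (Suc n), jm (Suc (Suc n)), jmsum n]" for B C f
    using that jm_commute jm_jmsum_commute by auto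
  show "symop (perms k) B" if "B \<in> set [jm (Suc n), jm (Suc (Suc n)), jmsum n]" for B
    using that k by (auto simp: symop_jm[simplified] symop_jmsum[simplified])
  fix v assume v: "supported (perms k) v" "v \<noteq> (\<lambda>x. 0)"
    and "\<And>B. B \<in> set [jm (Suc n), jm (Suc (Suc n)), jmsum n] \<Longrightarrow> \<exists>l. B v = (\<lambda>x. l * v x)"
  then obtain a b c where a: "jm (Suc n) v = (\<lambda>x. a * v x)"
    and b: "jm (Suc (Suc n)) v = (\<lambda>x. b * v x)" and c: "jmsum n v = (\<lambda>x. c * v x)"
    by (metis list.set_intros)
  let ?ip = "ip (perms k)"
  define N where "N = ?ip v v"
  define s where "s = trop (Suc n) (Suc (Suc n))"
  define d where "d = b - a"
  define u where "u = (\<lambda>x. v x + (- d) * s v x)"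
  have N: "0 < N" unfolding N_def by (rule ip_self_pos[OF finite_perms v])
  have sym_s: "symop (perms k) s" unfolding s_def by (rule symop_trop) (use k in auto)
  have ss: "s (s f) = f" for f unfolding s_def by (rule trop_trop)
  have s_lin: "s (\<lambda>x. f x + e * g x) = (\<lambda>x. s f x + e * s g x)" for f g e
    by (rule symop_linear[OF sym_s])
  have s_cmult: "s (\<lambda>x. e * f x) = (\<lambda>x. e * s f x)" for e f
    by (simp add: s_def trop_def)
  have y: "jm (Suc (Suc n)) f = (\<lambda>x. s f x + s (jm (Suc n) (s f)) x)" for f
    using jm_Suc[of "Suc n" f] by (auto simp: s_def)
  have ysv: "jm (Suc (Suc n)) (s v) = (\<lambda>x. v x + a * s v x)"
    unfolding y ss a s_cmult by simp
  \<comment> \<open>By \<open>y\<close>, \<open>s (jm (Suc n) (s v)) = b v - s v\<close>; applying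
    \<open>s\<close> once more isolates \<open>jm (Suc n) (s v)\<close>.\<close>
  have xsv: "jm (Suc n) (s v) = (\<lambda>x. b * s v x + (-1) * v x)"
  proof -
    have "s (jm (Suc n) (s v)) = (\<lambda>x. b * v x + (-1) * s v x)"
    proof
      fix x show "s (jm (Suc n) (s v)) x = b * v x + (-1) * s v x"
        using fun_cong[OF y[of v], of x] fun_cong[OF b, of x] by simp
    qed
    then have "s (s (jm (Suc n) (s v))) = s (\<lambda>x. b * v x + (-1) * s v x)" by simp
    then show ?thesis unfolding ss s_lin s_cmult .
  qed
  have su: "supported (perms k) u" "supported (perms k) (s v)"
    unfolding u_def by (intro supported_add_cmult symop_supported[OF sym_s] v)+
  \<comment> \<open>The term \<open>-v\<close> in \<open>xsv\<close> contributes \<open>d v\<close>,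
    and \<open>a + d = b\<close>.\<close>
  have xu: "jm (Suc n) u = (\<lambda>x. b * u x)"
    unfolding u_def lin a xsv by (simp add: d_def algebra_simps fun_eq_iff)
  have zu: "jmsum n u = (\<lambda>x. c * u x)"
  proof -
    have "jmsum n (s v) = s (jmsum n v)"
      unfolding s_def by (rule trop_jmsum_commute[symmetric]) auto
    then show ?thesis unfolding u_def lin c s_cmult by (simp add: c s_cmult algebra_simps)
  qed
  \<comment> \<open>Evaluating the form of \<open>jm (Suc n)\<close> at \<open>v\<close> and
    \<open>s v\<close> from either side gives
    \<open>b \<langle>v, s v\<rangle> - N = a \<langle>v, s v\<rangle>\<close>.\<close>
  have dsv: "d * ?ip v (s v) = N"
  proof -
    have "?ip v (jm (Suc n) (s v)) = ?ip (jm (Suc n) v) (s v)"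
      by (rule symop_sym[OF symop_jm]) (use k v su in auto)
    then show ?thesis
      unfolding xsv a ip_add_right ip_cmult_right ip_cmult_left N_def d_def
      by (simp add: algebra_simps)
  qed
  have sN: "?ip (s v) (s v) = N"
    using symop_sym[OF sym_s v(1) su(2)] unfolding ss N_def by simp
  have uN: "?ip u u = (d\<^sup>2 - 1) * N"
  proof -
    have "?ip u u = N - 2 * (d * ?ip v (s v)) + d\<^sup>2 * N"
      unfolding u_def ip_add_left ip_add_right ip_commute[of _ "s v" v] sN
      by (simp add: N_def algebra_simps power2_eq_square)
    then show ?thesis unfolding dsv by (simp add: algebra_simps)
  qed
  \<comment> \<open>The scalar term of \<open>octo (Suc n)\<close>. On a vector with eigenvalues
    \<open>c\<close> of \<open>jmsum n\<close> and \<open>e\<close> of \<open>jm (Suc n)\<close>,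
    that operator acts as \<open>C + (c + e) - (n + 1) e = C + c - n e\<close>.\<close>
  define C where "C = real (Suc n) * (real (Suc n) - 1) / 2"
  have jS: "jmsum (Suc n) w = (\<lambda>x. (c + e) * w x)"
    if "jmsum n w = (\<lambda>x. c * w x)" "jm (Suc n) w = (\<lambda>x. e * w x)" for w e
    using that by (simp add: jmsum_Suc fun_eq_iff algebra_simps)
  have "0 \<le> C * ?ip u u + (c + b) * ?ip u u - real (Suc n) * (b * ?ip u u)"
    using P[OF su(1)] unfolding ip_octo jS[OF zu xu] xu ip_cmult_right C_def .
  then have Pu: "0 \<le> (C + c - real n * b) * ?ip u u" by (simp add: algebra_simps)
  have "0 \<le> C * N + (c + a) * N - real (Suc n) * (a * N)"
    using P[OF v(1)] unfolding ip_octo jS[OF c a] a ip_cmult_right C_def N_def .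
  then have "0 \<le> (C + c - real n * a) * N" by (simp add: algebra_simps)
  then have Pv: "0 \<le> C + c - real n * a" using N by (simp add: zero_le_mult_iff)
  have "0 \<le> C * N - (c + a) * N + real (Suc n) * (a * N)"
    using octo_sign_twist[OF P _ v(1)] k
    unfolding jS[OF c a] a ip_cmult_right C_def N_def by simp
  then have "0 \<le> (C - c + real n * a) * N" by (simp add: algebra_simps)
  then have Qv: "0 \<le> C - c + real n * a" using N by (simp add: zero_le_mult_iff)
  \<comment> \<open>This number is the eigenvalue of \<open>octo (Suc (Suc n))\<close> at
    \<open>v\<close>. It also equals \<open>(C + c - n a) + (n + 1) (1 - d)\<close>, which settles
    \<open>d \<le> 1\<close>.\<close>
  have "0 \<le> C + c - real n * b + real (Suc n) - d"
  proof (cases "d \<le> 1")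
    case True
    then have "0 \<le> real (Suc n) * (1 - d)" by simp
    then show ?thesis using Pv by (simp add: d_def algebra_simps)
  next
    case False
    then have d1: "1 < d" by simp
    then have "1 < d\<^sup>2" by (simp add: one_less_power)
    then have "0 < ?ip u u" unfolding uN using N by simp
    then have Pb: "0 \<le> C + c - real n * b" using Pu by (simp add: zero_le_mult_iff)
    \<comment> \<open>For \<open>n > 0\<close>, adding \<open>Pb\<close> and \<open>Qv\<close> gives
      \<open>n d \<le> 2 C = n (n + 1)\<close>, and \<open>n\<close> cancels. For
      \<open>n = 0\<close>, \<open>jm 1 = 0\<close> forces \<open>a = 0\<close> and
      \<open>s v = b v\<close>, so \<open>dsv\<close> yields \<open>d^2 = 1\<close>, contradicting
      \<open>d > 1\<close>.\<close>
    have "d \<le> real (Suc n)"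
    proof (cases "n = 0")
      case True
      have a0: "a * v x = 0" for x using fun_cong[OF a, of x] True by (simp add: jm_def)
      have "a = 0" using a0 v(2) by auto
      have sv: "s v = (\<lambda>x. b * v x)"
        using b unfolding y using True by (simp add: jm_def s_def trop_def)
      have "d\<^sup>2 * N = N"
        using dsv \<open>a = 0\<close> unfolding sv ip_cmult_right N_def
        by (simp add: d_def power2_eq_square)
      then show ?thesis using N \<open>1 < d\<^sup>2\<close> by simp
    next
      case False
      have "real n * d \<le> 2 * C"
        using Pb Qv by (simp add: d_def algebra_simps)
      also have "2 * C = real n * real (Suc n)"
        by (simp add: C_def)
      finally show ?thesis using False by simp
    qed
    then show ?thesis using Pb by simp
  qed
  moreover have "?ip v (octo (Suc (Suc n)) v) = (C + c - real n * b + real (Suc n) - d) * N"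
  proof -
    have jSS: "jmsum (Suc (Suc n)) v = (\<lambda>x. (c + a + b) * v x)"
      unfolding jmsum_Suc[abs_def] jS[OF c a] b
      by (simp add: fun_eq_iff jmsum_Suc fun_cong[OF c] fun_cong[OF a] fun_cong[OF b] algebra_simps)
    show ?thesis
      unfolding ip_octo jSS b ip_cmult_right N_def[symmetric]
      by (simp add: C_def d_def field_simps)
  qed
  ultimately show "0 \<le> ?ip v (octo (Suc (Suc n)) v)" using N by simp
qed (rule f)

text \<open>The operator vanishes for \<open>m = 0\<close> and \<open>m = 1\<close>; from there
  \<open>octo_step\<close> raises \<open>m\<close> by one.\<close>

lemma octo_psd:
  assumes "m \<le> k" "supported (perms k) f"
  shows "0 \<le> ip (perms k) f (octo m f)"
  using assms
proof (induction m arbitrary: f rule: induct_nat_012)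
  case (ge2 n)
  show ?case by (rule octo_step) (use ge2 in auto)
qed (simp_all add: octo_def jmsum_def jm_def ip_def)

section \<open>Dirichlet forms\<close>

text \<open>Expand the square; \<open>trop a b\<close> preserves the norm.\<close>

lemma sum_sq_diff_trop:
  assumes "a \<in> {1..k}" "b \<in> {1..k}"
  shows "(\<Sum>\<sigma>\<in>perms k. (g \<sigma> - g (transpose a b \<circ> \<sigma>))\<^sup>2)
    = 2 * (ip (perms k) g g - ip (perms k) g (trop a b g))"
proof -
  have "ip (perms k) (trop a b g) (trop a b g) = ip (perms k) g g"
    unfolding ip_trop[OF assms] trop_trop ..
  moreover have "(\<Sum>\<sigma>\<in>perms k. (g \<sigma> - g (transpose a b \<circ> \<sigma>))\<^sup>2)
    = ip (perms k) g g - 2 * ip (perms k) g (trop a b g) + ip (perms k) (trop a b g) (trop a b g)"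
    unfolding ip_def trop_def sum_distrib_left sum_subtractf[symmetric] sum.distrib[symmetric]
    by (intro sum.cong refl) (simp add: power2_eq_square algebra_simps)
  ultimately show ?thesis by simp
qed

lemma ip_jm: "ip S f (jm m f) = (\<Sum>i\<in>{1..<m}. ip S f (trop i m f))"
  unfolding ip_def jm_def sum_distrib_left by (rule sum.swap)

lemma ip_cong_perms:
  assumes "m \<le> k" "\<And>\<sigma>. \<sigma> \<in> perms k \<Longrightarrow> f \<sigma> = g \<sigma>"
  shows "ip (perms k) f (jm m f) = ip (perms k) g (jm m g)"
  unfolding ip_def jm_def trop_def
  using assms by (intro sum.cong refl arg_cong2[where f = "(*)"])
    (auto simp: transpose_comp_permutes_iff)

text \<open>Carries \<open>octo_psd\<close> over to arbitrary \<open>g\<close> by cutting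
  \<open>g\<close> off outside \<open>perms k\<close>; the forms see only values on
  \<open>perms k\<close>, which the transpositions involved preserve.\<close>

lemma octo_psd_form:
  assumes "m \<le> k"
  shows "0 \<le> real m * (real m - 1) / 2 * ip (perms k) g g
    + (\<Sum>j\<in>{1..m}. ip (perms k) g (jm j g)) - real m * ip (perms k) g (jm m g)"
proof -
  define f where "f = (\<lambda>\<sigma>. if \<sigma> \<in> perms k then g \<sigma> else 0)"
  have "supported (perms k) f" by (simp add: supported_def f_def)
  then have "0 \<le> ip (perms k) f (octo m f)" by (rule octo_psd[OF assms])
  moreover have "ip (perms k) f (jm j f) = ip (perms k) g (jm j g)" if "j \<le> m" for j
    by (rule ip_cong_perms) (use that assms in \<open>auto simp: f_def\<close>)
  moreover have "ip (perms k) f f = ip (perms k) g g"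
    unfolding ip_def by (intro sum.cong refl) (simp add: f_def)
  ultimately show ?thesis by (simp add: ip_octo ip_jmsum)
qed

theorem mainTheorem4:
  fixes k :: nat and \<gamma> :: "nat \<Rightarrow> real" and g :: "(nat \<Rightarrow> nat) \<Rightarrow> real"
  assumes "k \<ge> 2"
    and "\<And>i j. i \<in> {1..k-1} \<Longrightarrow> j \<in> {1..k-1} \<Longrightarrow> \<gamma> i = \<gamma> j"
    and "\<And>i. i \<in> {1..k-1} \<Longrightarrow> \<gamma> i \<ge> 0"
  shows "(\<Sum>\<sigma> | \<sigma> permutes {1..k}. \<Sum>i=1..k-1.
            \<gamma> i * (g \<sigma> - g (transpose i k \<circ> \<sigma>))\<^sup>2)
         \<ge> (\<Sum>\<sigma> | \<sigma> permutes {1..k}. \<Sum>(i, j)\<in>{(i, j). 1 \<le> i \<and> i < j \<and> j \<le> k-1}.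
            \<gamma> i * \<gamma> j / (\<Sum>l=1..k-1. \<gamma> l) * (g \<sigma> - g (transpose i j \<circ> \<sigma>))\<^sup>2)"
proof -
  define n where "n = k - 1"
  have kn: "k = Suc n" and n: "1 \<le> n" using assms(1) by (auto simp: n_def)
  define c where "c = \<gamma> 1"
  have \<gamma>: "\<gamma> i = c" if "i \<in> {1..n}" for i
    unfolding c_def by (rule assms(2)) (use that n in \<open>auto simp: n_def\<close>)
  have c: "0 \<le> c" unfolding c_def by (rule assms(3)) (use n in \<open>auto simp: n_def\<close>)
  define D where "D = {(i, j). 1 \<le> i \<and> i < j \<and> j \<le> n}"
  let ?ip = "ip (perms k)"
  define N where "N = ?ip g g"
  define Z where "Z = (\<Sum>j\<in>{1..n}. ?ip g (jm j g))"
  define X where "X = ?ip g (jm k g)"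
  let ?q = "\<lambda>a b \<sigma>. (g \<sigma> - g (transpose a b \<circ> \<sigma>))\<^sup>2"
  have "(\<Sum>\<sigma>\<in>perms k. \<Sum>i=1..n. \<gamma> i * ?q i k \<sigma>) = (\<Sum>i=1..n. c * (\<Sum>\<sigma>\<in>perms k. ?q i k \<sigma>))"
    unfolding sum_distrib_left by (subst sum.swap) (intro sum.cong refl, simp add: \<gamma>)
  also have "\<dots> = (\<Sum>i=1..n. c * (2 * (N - ?ip g (trop i k g))))"
    by (intro sum.cong refl, subst sum_sq_diff_trop) (auto simp: kn N_def)
  also have "\<dots> = 2 * c * (real n * N - X)"
    unfolding X_def ip_jm kn
    by (simp add: sum_distrib_left[symmetric] sum_subtractf atLeastLessThanSuc_atLeastAtMost)
  finally have lhs: "(\<Sum>\<sigma>\<in>perms k. \<Sum>i=1..n. \<gamma> i * ?q i k \<sigma>) = 2 * c * (real n * N - X)" .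
  have sum\<gamma>: "(\<Sum>l=1..n. \<gamma> l) = real n * c" by (simp add: \<gamma>)
  \<comment> \<open>Pairs are grouped by their larger entry \<open>j\<close>, so that the inner sums
    become the forms of \<open>jm j\<close>.\<close>
  have D: "D = prod.swap ` (SIGMA j:{1..n}. {1..<j})"
    by (auto simp: D_def image_iff)
  have sumD: "(\<Sum>(i, j)\<in>D. F i j) = (\<Sum>j=1..n. \<Sum>i=1..<j. F i j)" for F :: "nat \<Rightarrow> nat \<Rightarrow> real"
    unfolding D by (subst sum.reindex) (simp_all add: sum.Sigma case_prod_unfold)
  have "(\<Sum>\<sigma>\<in>perms k. \<Sum>(i, j)\<in>D. \<gamma> i * \<gamma> j / (\<Sum>l=1..n. \<gamma> l) * ?q i j \<sigma>)
      = (\<Sum>(i, j)\<in>D. c * c / (real n * c) * (\<Sum>\<sigma>\<in>perms k. ?q i j \<sigma>))"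
    unfolding sum_distrib_left case_prod_unfold sum\<gamma>
    by (subst sum.swap) (intro sum.cong refl, auto simp: \<gamma> D_def)
  \<comment> \<open>The cancellation \<open>c * c / (n * c) = c / n\<close> also holds for
    \<open>c = 0\<close>, since division by zero yields \<open>0\<close>.\<close>
  also have "\<dots> = (\<Sum>(i, j)\<in>D. c / real n * (2 * (N - ?ip g (trop i j g))))"
    by (intro sum.cong refl, clarsimp simp only: D_def prod.case mem_Collect_eq, subst sum_sq_diff_trop)
      (auto simp: kn N_def)
  also have "\<dots> = 2 * c / real n * (\<Sum>j=1..n. \<Sum>i=1..<j. N - ?ip g (trop i j g))"
    unfolding sumD sum_distrib_left by (simp add: algebra_simps)
  also have "(\<Sum>j=1..n. \<Sum>i=1..<j. N - ?ip g (trop i j g)) = real n * (real n - 1) / 2 * N - Z"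
  proof -
    have "(\<Sum>j=1..n. real (j - 1)) = real n * (real n - 1) / 2"
      by (induction n) (auto simp: field_simps)
    then show ?thesis
      unfolding Z_def ip_jm by (simp add: sum_subtractf sum_distrib_right[symmetric])
  qed
  finally have rhs: "(\<Sum>\<sigma>\<in>perms k. \<Sum>(i, j)\<in>D. \<gamma> i * \<gamma> j / (\<Sum>l=1..n. \<gamma> l) * ?q i j \<sigma>)
      = 2 * c / real n * (real n * (real n - 1) / 2 * N - Z)" .
  \<comment> \<open>The sum over \<open>j \<le> k\<close> splits into \<open>Z\<close> and its last
    term \<open>X\<close>. With \<open>k = n + 1\<close>, the next inequality rests on
    \<open>n (n + 1) / 2 + n (n - 1) / 2 = n^2\<close>.\<close>
  have "0 \<le> real k * (real k - 1) / 2 * N + (Z + X) - real k * X"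
    using octo_psd_form[of k k g] unfolding N_def Z_def X_def by (simp add: kn)
  then have "real n * (real n - 1) / 2 * N - Z \<le> real n * (real n * N - X)"
    by (simp add: kn field_simps)
  then have "2 * c / real n * (real n * (real n - 1) / 2 * N - Z)
      \<le> 2 * c / real n * (real n * (real n * N - X))"
    by (intro mult_left_mono) (use c in auto)
  also have "\<dots> = 2 * c * (real n * N - X)" using n by simp
  finally show ?thesis
    unfolding n_def[symmetric] lhs D_def[symmetric] rhs .
qed

end
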